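(* Let $\mathcal{T}$ be Bourbaki's theory of sets. In this theory the words "set" and "term" are strictly synonymous. Call two terms distinct (or different) if they are different as formal expressions, and call two terms $X,Y$ equal if the relation $X=Y$ is a theorem of $\mathcal{T}$. Then: (1) There are only countably many sets, i.e. the collection of all terms of $\mathcal{T}$ is countable. (2) Different sets can be equal. More precisely, for every term $X$ there is an infinite sequence $X_1,X_2,\dots$ of pairwise distinct terms such that, for every $i\ge 1$, the relation $X_i=X$ is a theorem of $\mathcal{T}$. (3) In particular, any nonempty set has infinitely many elements: if $X$ is a term such that $X\neq\varnothing$ is a theorem of $\mathcal{T}$, then there are infinitely many pairwise distinct terms $Y$ such that $Y\in X$ is a theorem of $\mathcal{T}$.
   Context: All statements are metamathematical statements about the formal theory $\mathcal{T}$ of Bourbaki's "Théorie des ensembles". Syntax. The signs are the logical signs $\tau,\ \square,\ \vee,\ \neg$, countably many letters, and the binary specific signs $=$ and $\in$. Terms and relations are finite expressions defined by simultaneous recursion: every letter is a term; if $T,U$ are terms, then $T=U$ and $T\in U$ are relations; if $R,S$ are relations, then $\neg R$ and $R\vee S$ are relations; if $R$ is a relation and $x$ a letter, then $\tau_x(R)$ is a term, namely the expression obtained by writing $\tau$ in front of $R$, linking this $\tau$ to each occurrence of $x$ in $R$, and replacing these occurrences by $\square$. Thus $x$ does not occur in $\tau_x(R)$ and expressions differing only by renaming of bound letters are identical. $(T|x)R$ denotes the result of replacing the letter $x$ by the term $T$ in $R$. Abbreviations. $R\Rightarrow S$ is $(\neg R)\vee S$; "and" and $\Leftrightarrow$ are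 defined as usual; $(\exists x)R$ is $(\tau_x(R)|x)R$; $(\forall x)R$ is $\neg(\exists x)\neg R$; $T\neq U$ is $\neg(T=U)$; $T\notin U$ is $\neg(T\in U)$; $\mathrm{Coll}_x R$ is $(\exists y)(\forall x)((x\in y)\Leftrightarrow R)$ with $y$ a letter distinct from $x$ and not occurring in $R$; $\varnothing$ is $\tau_X((\forall x)(x\notin X))$. Axioms (for all relations $A,B,C,R,S$, terms $T,U$ and letters $x$). S1: $(A\vee A)\Rightarrow A$. S2: $A\Rightarrow(A\vee B)$. S3: $(A\vee B)\Rightarrow(B\vee A)$. S4: $(A\Rightarrow B)\Rightarrow((C\vee A)\Rightarrow(C\vee B))$. S5: $(T|x)R\Rightarrow(\exists x)R$. S6: $(T=U)\Rightarrow((T|x)R\Leftrightarrow(U|x)R)$. S7: $((\forall x)(R\Leftrightarrow S))\Rightarrow(\tau_x(R)=\tau_x(S))$. S8 (selection and union): $(\forall y)(\exists X)(\forall x)(R\Rightarrow(x\in X))\Rightarrow(\forall Y)\,\mathrm{Coll}_x((\exists y)((y\in Y)\text{ and }R))$, where $x,y,X,Y$ are distinct letters and $X,Y$ do not occur in $R$. Explicit axioms: extensionality; for all $x,y$ there is a set whose elements are exactly $x$ and $y$; every set has a power set; there exists an infinite set. A theorem of $\mathcal{T}$ is a relation obtained from the axioms by finitely many applications of modus ponens (from $R$ and $R\Rightarrow S$ infer $S$). *)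

theory Defs
  imports Main "HOL-Library.Countable_Set"
begin

text \<open>
  Formal expressions. Letters are indexed by natural numbers. A link from a place-holder to its
  governing \<open>\<tau>\<close> is recorded by a number: \<open>Box k\<close> is linked to the \<open>\<tau>\<close> reached by passing over the
  \<open>k\<close> innermost \<open>\<tau>\<close>s enclosing it. So two expressions with links coincide iff the corresponding
  HOL values are equal, and there are no bound letters at all. The two types also contain
  expressions with unlinked boxes; \<open>is_term\<close> and \<open>is_rel\<close> below single out the genuine terms and
  relations.
\<close>

datatype trm = Letter nat | Box nat | Tau reln
  and reln = Equal trm trm | Elem trm trm | Neg reln | Or reln reln

text \<open>\<open>link x k E\<close> replaces each \<open>x\<close> in \<open>E\<close> by a box linked to the \<open>\<tau>\<close> lying \<open>k\<close> levels outside \<open>E\<close>.\<close>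

primrec link_trm :: "nat \<Rightarrow> nat \<Rightarrow> trm \<Rightarrow> trm"
  and link_rel :: "nat \<Rightarrow> nat \<Rightarrow> reln \<Rightarrow> reln" where
  "link_trm x k (Letter y) = (if y = x then Box k else Letter y)"
| "link_trm x k (Box j) = Box j"
| "link_trm x k (Tau R) = Tau (link_rel x (Suc k) R)"
| "link_rel x k (Equal T U) = Equal (link_trm x k T) (link_trm x k U)"
| "link_rel x k (Elem T U) = Elem (link_trm x k T) (link_trm x k U)"
| "link_rel x k (Neg R) = Neg (link_rel x k R)"
| "link_rel x k (Or R S) = Or (link_rel x k R) (link_rel x k S)"

definition tau :: "nat \<Rightarrow> reln \<Rightarrow> trm" where
  "tau x R = Tau (link_rel x 0 R)"

inductive is_term :: "trm \<Rightarrow> bool" and is_rel :: "reln \<Rightarrow> bool" where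
  "is_term (Letter x)"
| "is_term T \<Longrightarrow> is_term U \<Longrightarrow> is_rel (Equal T U)"
| "is_term T \<Longrightarrow> is_term U \<Longrightarrow> is_rel (Elem T U)"
| "is_rel R \<Longrightarrow> is_rel (Neg R)"
| "is_rel R \<Longrightarrow> is_rel S \<Longrightarrow> is_rel (Or R S)"
| "is_rel R \<Longrightarrow> is_term (tau x R)"

primrec letters_trm :: "trm \<Rightarrow> nat set"
  and letters_rel :: "reln \<Rightarrow> nat set" where
  "letters_trm (Letter x) = {x}"
| "letters_trm (Box k) = {}"
| "letters_trm (Tau R) = letters_rel R"
| "letters_rel (Equal T U) = letters_trm T \<union> letters_trm U"
| "letters_rel (Elem T U) = letters_trm T \<union> letters_trm U"
| "letters_rel (Neg R) = letters_rel R"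
| "letters_rel (Or R S) = letters_rel R \<union> letters_rel S"

text \<open>
  \<open>subst_rel T x R\<close> is \<open>(T|x)R\<close>. No capture can occur: a term \<open>T\<close> has no unlinked boxes.
\<close>

primrec subst_trm :: "trm \<Rightarrow> nat \<Rightarrow> trm \<Rightarrow> trm"
  and subst_rel :: "trm \<Rightarrow> nat \<Rightarrow> reln \<Rightarrow> reln" where
  "subst_trm T x (Letter y) = (if y = x then T else Letter y)"
| "subst_trm T x (Box k) = Box k"
| "subst_trm T x (Tau R) = Tau (subst_rel T x R)"
| "subst_rel T x (Equal U V) = Equal (subst_trm T x U) (subst_trm T x V)"
| "subst_rel T x (Elem U V) = Elem (subst_trm T x U) (subst_trm T x V)"
| "subst_rel T x (Neg R) = Neg (subst_rel T x R)"
| "subst_rel T x (Or R S) = Or (subst_rel T x R) (subst_rel T x S)"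

definition Imp :: "reln \<Rightarrow> reln \<Rightarrow> reln" where
  "Imp R S = Or (Neg R) S"

definition And :: "reln \<Rightarrow> reln \<Rightarrow> reln" where
  "And R S = Neg (Or (Neg R) (Neg S))"

definition Iff :: "reln \<Rightarrow> reln \<Rightarrow> reln" where
  "Iff R S = And (Imp R S) (Imp S R)"

definition Exists :: "nat \<Rightarrow> reln \<Rightarrow> reln" where
  "Exists x R = subst_rel (tau x R) x R"

definition Forall :: "nat \<Rightarrow> reln \<Rightarrow> reln" where
  "Forall x R = Neg (Exists x (Neg R))"

text \<open>
  The letters \<open>fresh A 0\<close>, \<open>fresh A 1\<close>, \<dots> are distinct and outside the finite set \<open>A\<close>. They are only
  used in positions that get bound, so the choice does not affect the resulting expression.
\<close>

definition fresh :: "nat set \<Rightarrow> nat \<Rightarrow> nat" where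
  "fresh A i = Suc (Max (insert 0 A)) + i"

definition Coll :: "nat \<Rightarrow> reln \<Rightarrow> reln" where
  "Coll x R = (let y = fresh (insert x (letters_rel R)) 0
     in Exists y (Forall x (Iff (Elem (Letter x) (Letter y)) R)))"

definition Empty :: trm where
  "Empty = tau 1 (Forall 0 (Neg (Elem (Letter 0) (Letter 1))))"

definition Subset :: "trm \<Rightarrow> trm \<Rightarrow> reln" where
  "Subset T U = (let z = fresh (letters_trm T \<union> letters_trm U) 0
     in Forall z (Imp (Elem (Letter z) T) (Elem (Letter z) U)))"

text \<open>
  The remaining abbreviations, needed to write down the axiom of infinity, follow Bourbaki:
  the set of all \<open>x\<close> with \<open>R\<close>, Kuratowski pairs, products, equipotence (through the graph of a
  bijection), \<open>Card(X) = \<tau>\<^sub>Z(Eq(X,Z))\<close>, the cardinal sum as cardinal of the set-theoretic sum;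
  \<open>X\<close> is finite if \<open>Card(X) \<noteq> Card(X) + 1\<close>.
\<close>

definition SetOf :: "nat \<Rightarrow> reln \<Rightarrow> trm" where
  "SetOf x R = (let y = fresh (insert x (letters_rel R)) 0
     in tau y (Forall x (Iff (Elem (Letter x) (Letter y)) R)))"

definition UPair :: "trm \<Rightarrow> trm \<Rightarrow> trm" where
  "UPair T U = (let z = fresh (letters_trm T \<union> letters_trm U) 0
     in SetOf z (Or (Equal (Letter z) T) (Equal (Letter z) U)))"

definition Sing :: "trm \<Rightarrow> trm" where
  "Sing T = UPair T T"

definition OPair :: "trm \<Rightarrow> trm \<Rightarrow> trm" where
  "OPair T U = UPair (Sing T) (UPair T U)"

definition Times :: "trm \<Rightarrow> trm \<Rightarrow> trm" where
  "Times A B = (let S = letters_trm A \<union> letters_trm B; x = fresh S 0; y = fresh S 1; z = fresh S 2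
     in SetOf z (Exists x (Exists y (And (Equal (Letter z) (OPair (Letter x) (Letter y)))
          (And (Elem (Letter x) A) (Elem (Letter y) B))))))"

definition Equipotent :: "trm \<Rightarrow> trm \<Rightarrow> reln" where
  "Equipotent A B = (let S = letters_trm A \<union> letters_trm B;
       F = fresh S 0; x = fresh S 1; x' = fresh S 2; y = fresh S 3; y' = fresh S 4;
       G = (\<lambda>u v. Elem (OPair (Letter u) (Letter v)) (Letter F))
     in Exists F (And (Subset (Letter F) (Times A B))
         (And (And (Forall x (Imp (Elem (Letter x) A) (Exists y (G x y))))
                   (Forall x (Forall y (Forall y' (Imp (And (G x y) (G x y')) (Equal (Letter y) (Letter y')))))))
              (And (Forall y (Imp (Elem (Letter y) B) (Exists x (G x y))))
                   (Forall x (Forall x' (Forall y (Imp (And (G x y) (G x' y)) (Equal (Letter x) (Letter x'))))))))))"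

definition Card :: "trm \<Rightarrow> trm" where
  "Card X = (let z = fresh (letters_trm X) 0 in tau z (Equipotent X (Letter z)))"

definition DisjointSum :: "trm \<Rightarrow> trm \<Rightarrow> trm" where
  "DisjointSum A B = (let z = fresh (letters_trm A \<union> letters_trm B) 0
     in SetOf z (Or (Elem (Letter z) (Times A (Sing Empty)))
                    (Elem (Letter z) (Times B (Sing (Sing Empty))))))"

definition CardPlus :: "trm \<Rightarrow> trm \<Rightarrow> trm" where
  "CardPlus A B = Card (DisjointSum A B)"

definition One :: trm where
  "One = Card (Sing Empty)"

definition Finite :: "trm \<Rightarrow> reln" where
  "Finite X = Neg (Equal (Card X) (CardPlus (Card X) One))"

definition Infinite :: "trm \<Rightarrow> reln" where
  "Infinite X = Neg (Finite X)"

inductive axiom :: "reln \<Rightarrow> bool" where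
  S1: "is_rel A \<Longrightarrow> axiom (Imp (Or A A) A)"
| S2: "is_rel A \<Longrightarrow> is_rel B \<Longrightarrow> axiom (Imp A (Or A B))"
| S3: "is_rel A \<Longrightarrow> is_rel B \<Longrightarrow> axiom (Imp (Or A B) (Or B A))"
| S4: "is_rel A \<Longrightarrow> is_rel B \<Longrightarrow> is_rel C \<Longrightarrow> axiom (Imp (Imp A B) (Imp (Or C A) (Or C B)))"
| S5: "is_rel R \<Longrightarrow> is_term T \<Longrightarrow> axiom (Imp (subst_rel T x R) (Exists x R))"
| S6: "is_rel R \<Longrightarrow> is_term T \<Longrightarrow> is_term U \<Longrightarrow>
    axiom (Imp (Equal T U) (Iff (subst_rel T x R) (subst_rel U x R)))"
| S7: "is_rel R \<Longrightarrow> is_rel S \<Longrightarrow> axiom (Imp (Forall x (Iff R S)) (Equal (tau x R) (tau x S)))"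
| S8: "is_rel R \<Longrightarrow> distinct [x, y, X, Y] \<Longrightarrow> X \<notin> letters_rel R \<Longrightarrow> Y \<notin> letters_rel R \<Longrightarrow>
    axiom (Imp (Forall y (Exists X (Forall x (Imp R (Elem (Letter x) (Letter X))))))
               (Forall Y (Coll x (Exists y (And (Elem (Letter y) (Letter Y)) R)))))"
| extensionality:
    "axiom (Forall 0 (Forall 1 (Imp (And (Subset (Letter 0) (Letter 1)) (Subset (Letter 1) (Letter 0)))
                              (Equal (Letter 0) (Letter 1)))))"
| pairing:
    "axiom (Forall 0 (Forall 1 (Coll 2 (Or (Equal (Letter 2) (Letter 0)) (Equal (Letter 2) (Letter 1))))))"
| power_set: "axiom (Forall 0 (Coll 1 (Subset (Letter 1) (Letter 0))))"
| infinity: "axiom (Exists 0 (Infinite (Letter 0)))"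

inductive provable :: "reln \<Rightarrow> bool" where
  axiom: "axiom R \<Longrightarrow> provable R"
| modus_ponens: "provable R \<Longrightarrow> provable (Imp R S) \<Longrightarrow> provable S"

end

theory Submission imports Defs begin

text \<open>
  There are only countably many expressions, which gives the first claim.

  The other two rest on one observation. If some term \<open>T\<close> has the property \<open>R\<close> of the letter
  \<open>x\<close>, then by S5 the term \<open>\<tau>\<^sub>x(R)\<close> has it too. Apply this to \<open>R\<close> preceded by \<open>2i\<close> negations:
  the relation is equivalent to \<open>R\<close>, but the expressions \<open>\<tau>\<^sub>x(\<not>\<dots>\<not>R)\<close> have different lengths.
  So a property held by one term is held by infinitely many terms (\<open>infinitely_many_witnesses\<close>).

  With \<open>x = X\<close> for \<open>R\<close> and \<open>X\<close> for \<open>T\<close>, this yields infinitely many terms equal to \<open>X\<close>, provided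
  \<open>X = X\<close> is a theorem (\<open>Equal_refl\<close>). With \<open>x \<in> X\<close> for \<open>R\<close>, it yields infinitely many elements
  of \<open>X\<close>, provided \<open>X\<close> has at least one (\<open>nonempty_has_element\<close>). The latter follows from
  extensionality: if \<open>X\<close> has no element, then \<open>X\<close> witnesses that there is an empty set, so
  \<open>\<emptyset>\<close>, being \<open>\<tau>\<close> of that property, has no element either, and thus \<open>X = \<emptyset>\<close>.

  Throughout, \<open>(\<forall>x)R\<close> is literally \<open>\<not>\<not>(T|x)R\<close> for one particular term \<open>T\<close>. Therefore it is
  proved, even after substitutions, by proving this single instance.
\<close>

section \<open>Terms and relations as expressions without unlinked boxes\<close>

text \<open>
  The inductive definition of terms and relations is awkward under substitution, because in
  \<open>tau x R\<close> the letter \<open>x\<close> may occur in the substituted term. The following structural criterion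
  avoids this: at depth \<open>k\<close> every box must be linked to one of the \<open>k\<close> enclosing \<open>\<tau>\<close>s.
\<close>

primrec closed_trm :: "nat \<Rightarrow> trm \<Rightarrow> bool"
  and closed_rel :: "nat \<Rightarrow> reln \<Rightarrow> bool" where
  "closed_trm k (Letter y) = True"
| "closed_trm k (Box j) = (j < k)"
| "closed_trm k (Tau R) = closed_rel (Suc k) R"
| "closed_rel k (Equal T U) = (closed_trm k T \<and> closed_trm k U)"
| "closed_rel k (Elem T U) = (closed_trm k T \<and> closed_trm k U)"
| "closed_rel k (Neg R) = closed_rel k R"
| "closed_rel k (Or R S) = (closed_rel k R \<and> closed_rel k S)"

primrec unlink_trm :: "nat \<Rightarrow> nat \<Rightarrow> trm \<Rightarrow> trm"
  and unlink_rel :: "nat \<Rightarrow> nat \<Rightarrow> reln \<Rightarrow> reln" where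
  "unlink_trm x k (Letter y) = Letter y"
| "unlink_trm x k (Box j) = (if j = k then Letter x else Box j)"
| "unlink_trm x k (Tau R) = Tau (unlink_rel x (Suc k) R)"
| "unlink_rel x k (Equal T U) = Equal (unlink_trm x k T) (unlink_trm x k U)"
| "unlink_rel x k (Elem T U) = Elem (unlink_trm x k T) (unlink_trm x k U)"
| "unlink_rel x k (Neg R) = Neg (unlink_rel x k R)"
| "unlink_rel x k (Or R S) = Or (unlink_rel x k R) (unlink_rel x k S)"

lemma link_unlink:
  "x \<notin> letters_trm T \<Longrightarrow> link_trm x k (unlink_trm x k T) = T"
  "x \<notin> letters_rel R \<Longrightarrow> link_rel x k (unlink_rel x k R) = R"
  by (induction T and R arbitrary: k and k) auto

lemma size_unlink [simp]:
  "size (unlink_trm x k T) = size T"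
  "size (unlink_rel x k R) = size R"
  by (induction T and R arbitrary: k and k) auto

lemma closed_unlink:
  "closed_trm (Suc k) T \<Longrightarrow> closed_trm k (unlink_trm x k T)"
  "closed_rel (Suc k) R \<Longrightarrow> closed_rel k (unlink_rel x k R)"
  by (induction T and R arbitrary: k and k) auto

lemma closed_link:
  "closed_trm k T \<Longrightarrow> closed_trm (Suc k) (link_trm x k T)"
  "closed_rel k R \<Longrightarrow> closed_rel (Suc k) (link_rel x k R)"
  by (induction T and R arbitrary: k and k) auto

lemma closed_mono:
  "closed_trm k T \<Longrightarrow> k \<le> l \<Longrightarrow> closed_trm l T"
  "closed_rel k R \<Longrightarrow> k \<le> l \<Longrightarrow> closed_rel l R"
  by (induction T and R arbitrary: k l and k l) auto

lemma closed_subst: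
  "closed_trm 0 T \<Longrightarrow> closed_trm k U \<Longrightarrow> closed_trm k (subst_trm T x U)"
  "closed_trm 0 T \<Longrightarrow> closed_rel k R \<Longrightarrow> closed_rel k (subst_rel T x R)"
  by (induction U and R arbitrary: k and k) (auto intro: closed_mono)

lemma finite_letters: "finite (letters_trm T)" "finite (letters_rel R)"
  by (induction T and R) auto

text \<open>
  An expression \<open>Tau R\<close> is brought into the form \<open>tau x R'\<close> by writing a fresh letter into the
  boxes linked to the leading \<open>\<tau>\<close>. As \<open>R'\<close> is no subexpression, the induction is on the size.
\<close>

lemma closed_imp_term_rel:
  "(closed_trm 0 T \<longrightarrow> size T < n \<longrightarrow> is_term T) \<and> (closed_rel 0 R \<longrightarrow> size R < n \<longrightarrow> is_rel R)"
proof (induction n arbitrary: T R)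
  case 0
  then show ?case by simp
next
  case (Suc n)
  have "is_term T" if cl: "closed_trm 0 T" and sz: "size T < Suc n"
  proof (cases T)
    case (Tau S)
    obtain x where x: "x \<notin> letters_rel S"
      using ex_new_if_finite[OF infinite_UNIV_nat finite_letters(2)] by blast
    have "is_rel (unlink_rel x 0 S)"
      using Suc.IH[of _ "unlink_rel x 0 S"] cl sz Tau by (simp add: closed_unlink)
    then have "is_term (tau x (unlink_rel x 0 S))"
      by (rule is_term_is_rel.intros)
    then show ?thesis
      using Tau by (simp add: tau_def link_unlink x)
  qed (use cl in \<open>auto intro: is_term_is_rel.intros\<close>)
  moreover have "is_rel R" if "closed_rel 0 R" and "size R < Suc n"
    using that Suc.IH by (cases R) (auto intro!: is_term_is_rel.intros)
  ultimately show ?case by blast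
qed

lemma is_term_iff [simp]: "is_term T \<longleftrightarrow> closed_trm 0 T"
  and is_rel_iff [simp]: "is_rel R \<longleftrightarrow> closed_rel 0 R"
proof -
  have "is_term T \<Longrightarrow> closed_trm 0 T" and "is_rel R \<Longrightarrow> closed_rel 0 R" for T R
    by (induction rule: is_term_is_rel.inducts) (auto simp: tau_def closed_link)
  then show "is_term T \<longleftrightarrow> closed_trm 0 T" and "is_rel R \<longleftrightarrow> closed_rel 0 R"
    using closed_imp_term_rel by blast+
qed

lemma closed_derived [simp]:
  "closed_rel k (Imp R S) \<longleftrightarrow> closed_rel k R \<and> closed_rel k S"
  "closed_rel k (And R S) \<longleftrightarrow> closed_rel k R \<and> closed_rel k S"
  "closed_rel k (Iff R S) \<longleftrightarrow> closed_rel k R \<and> closed_rel k S"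
  by (auto simp: Imp_def And_def Iff_def)

lemma closed_tau [simp]: "closed_rel 0 R \<Longrightarrow> closed_trm 0 (tau x R)"
  by (simp add: tau_def closed_link)

lemma closed_quantified [simp]:
  "closed_rel 0 R \<Longrightarrow> closed_rel 0 (Exists x R)"
  "closed_rel 0 R \<Longrightarrow> closed_rel 0 (Forall x R)"
  by (simp_all add: Exists_def Forall_def closed_subst)

section \<open>Substitution\<close>

lemma link_fresh [simp]:
  "x \<notin> letters_trm T \<Longrightarrow> link_trm x k T = T"
  "x \<notin> letters_rel R \<Longrightarrow> link_rel x k R = R"
  by (induction T and R arbitrary: k and k) auto

lemma subst_fresh [simp]:
  "x \<notin> letters_trm U \<Longrightarrow> subst_trm T x U = U"
  "x \<notin> letters_rel R \<Longrightarrow> subst_rel T x R = R"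
  by (induction U and R) auto

lemma subst_link:
  assumes "x \<noteq> y" "y \<notin> letters_trm T"
  shows "subst_trm T x (link_trm y k U) = link_trm y k (subst_trm T x U)"
    and "subst_rel T x (link_rel y k R) = link_rel y k (subst_rel T x R)"
  using assms by (induction U and R arbitrary: k and k) auto

lemma subst_subst:
  assumes "x \<noteq> y" "y \<notin> letters_trm T"
  shows "subst_trm T x (subst_trm V y U) = subst_trm (subst_trm T x V) y (subst_trm T x U)"
    and "subst_rel T x (subst_rel V y R) = subst_rel (subst_trm T x V) y (subst_rel T x R)"
  using assms by (induction U and R) auto

lemma subst_derived [simp]:
  "subst_rel T x (Imp R S) = Imp (subst_rel T x R) (subst_rel T x S)"
  "subst_rel T x (And R S) = And (subst_rel T x R) (subst_rel T x S)"
  "subst_rel T x (Iff R S) = Iff (subst_rel T x R) (subst_rel T x S)"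
  by (auto simp: Imp_def And_def Iff_def)

lemma subst_Forall:
  assumes "x \<noteq> y" "y \<notin> letters_trm T"
  shows "subst_rel T x (Forall y R) = Forall y (subst_rel T x R)"
  using assms by (simp add: Forall_def Exists_def tau_def subst_link subst_subst)

lemma Forall_eq: "Forall x R = Neg (Neg (subst_rel (tau x (Neg R)) x R))"
  by (simp add: Forall_def Exists_def)

section \<open>Propositional logic\<close>

text \<open>
  The schemes S1 to S4 may only be applied to relations. This lemma supplies that condition for
  everything that occurs in a theorem already at hand. The laborious case is the axiom of
  infinity, whose abbreviations have to be traversed one by one.
\<close>

lemma provable_closed:
  assumes "provable R"
  shows "closed_rel 0 R"
proof -
  have terms: "closed_rel 0 R \<Longrightarrow> closed_trm 0 (SetOf x R)"
    "closed_trm 0 T \<Longrightarrow> closed_trm 0 U \<Longrightarrow> closed_trm 0 (UPair T U)" for x R T U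
    by (simp_all add: SetOf_def UPair_def Let_def)
  then have pairs: "closed_trm 0 T \<Longrightarrow> closed_trm 0 (Sing T)"
    "closed_trm 0 T \<Longrightarrow> closed_trm 0 U \<Longrightarrow> closed_trm 0 (OPair T U)" for T U
    by (simp_all add: Sing_def OPair_def)
  with terms have sets: "closed_trm 0 T \<Longrightarrow> closed_trm 0 U \<Longrightarrow> closed_rel 0 (Subset T U)"
    "closed_trm 0 T \<Longrightarrow> closed_trm 0 U \<Longrightarrow> closed_trm 0 (Times T U)" for T U
    by (simp_all add: Subset_def Times_def Let_def)
  have "closed_trm 0 T \<Longrightarrow> closed_trm 0 U \<Longrightarrow> closed_rel 0 (Equipotent T U)" for T U
    unfolding Equipotent_def Let_def
    by (intro closed_quantified closed_derived[THEN iffD2] conjI sets)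
      (auto simp: pairs sets)
  then have cards: "closed_trm 0 T \<Longrightarrow> closed_trm 0 (Card T)" for T
    by (simp add: Card_def Let_def)
  have "closed_trm 0 Empty"
    by (simp add: Empty_def)
  then have inf: "closed_rel 0 (Infinite (Letter 0))"
    by (simp add: Infinite_def Finite_def CardPlus_def One_def DisjointSum_def Let_def
        terms pairs sets cards)
  have axioms: "closed_rel 0 R" if "axiom R" for R
    using that
    by cases (auto simp: Coll_def Let_def sets inf closed_subst)
  from assms show ?thesis
    by (induction rule: provable.induct) (auto dest: axioms)
qed

lemma Imp_closed:
  assumes "provable (Imp A B)"
  shows "closed_rel 0 A" "closed_rel 0 B"
  using provable_closed[OF assms] by auto

lemma Or_mono:
  assumes "provable (Imp A B)" "closed_rel 0 C"
  shows "provable (Imp (Or C A) (Or C B))"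
proof (rule modus_ponens[rotated])
  show "provable (Imp (Imp A B) (Imp (Or C A) (Or C B)))"
    using assms Imp_closed[OF assms(1)] by (intro provable.axiom S4) auto
qed fact

lemma Imp_trans [trans]: "provable (Imp A B) \<Longrightarrow> provable (Imp B C) \<Longrightarrow> provable (Imp A C)"
  unfolding Imp_def[of A] using Or_mono[of B C "Neg A"] modus_ponens provable_closed
  by (metis closed_rel.simps(4))

lemma Imp_Or_swap: "closed_rel 0 A \<Longrightarrow> closed_rel 0 B \<Longrightarrow> provable (Imp (Or A B) (Or B A))"
  by (intro provable.axiom S3) auto

lemma Or_swap: "provable (Or A B) \<Longrightarrow> provable (Or B A)"
  using Imp_Or_swap provable_closed modus_ponens by (metis closed_rel.simps(4))

lemma Imp_Or_left: "closed_rel 0 A \<Longrightarrow> closed_rel 0 B \<Longrightarrow> provable (Imp A (Or A B))"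
  by (intro provable.axiom S2) auto

lemma Or_idem: "closed_rel 0 A \<Longrightarrow> provable (Imp (Or A A) A)"
  by (intro provable.axiom S1) auto

lemma Imp_refl: "closed_rel 0 A \<Longrightarrow> provable (Imp A A)"
  using Imp_trans[OF Imp_Or_left Or_idem] by blast

lemma Imp_weaken:
  assumes "closed_rel 0 A" "provable B"
  shows "provable (Imp A B)"
proof -
  have "provable (Or B (Neg A))"
    using assms provable_closed Imp_Or_left modus_ponens by (metis closed_rel.simps(3))
  then show ?thesis
    unfolding Imp_def by (rule Or_swap)
qed

lemma Neg_Imp: "closed_rel 0 A \<Longrightarrow> closed_rel 0 B \<Longrightarrow> provable (Imp (Neg A) (Imp A B))"
  unfolding Imp_def[of A] by (rule Imp_Or_left) auto

lemma Imp_Neg_Neg: "closed_rel 0 A \<Longrightarrow> provable (Imp A (Neg (Neg A)))"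
  using Or_swap[of "Neg (Neg A)" "Neg A"] Imp_refl[of "Neg A"] by (simp add: Imp_def)

lemma Neg_Neg_Imp:
  assumes A: "closed_rel 0 A"
  shows "provable (Imp (Neg (Neg A)) A)"
proof -
  have "provable (Or A (Neg A))"
    using Or_swap[of "Neg A" A] Imp_refl[OF A] by (simp add: Imp_def)
  moreover have "provable (Imp (Or A (Neg A)) (Or A (Neg (Neg (Neg A)))))"
    using A by (intro Or_mono Imp_Neg_Neg) auto
  ultimately show ?thesis
    unfolding Imp_def[of "Neg (Neg A)"] using Or_swap modus_ponens by blast
qed

lemma Neg_Neg_iff [simp]: "provable (Neg (Neg A)) \<longleftrightarrow> provable A"
  using Imp_Neg_Neg Neg_Neg_Imp modus_ponens provable_closed by (metis closed_rel.simps(3))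

lemma Imp_contrapos:
  assumes "provable (Imp A B)"
  shows "provable (Imp (Neg B) (Neg A))"
proof -
  have "provable (Imp A (Neg (Neg B)))"
    using assms Imp_closed Imp_Neg_Neg Imp_trans by blast
  then show ?thesis
    unfolding Imp_def by (rule Or_swap)
qed

lemma Or_elim:
  assumes A: "provable (Imp A C)" and B: "provable (Imp B C)"
  shows "provable (Imp (Or A B) C)"
proof -
  note cl = Imp_closed[OF A] Imp_closed[OF B]
  have "provable (Imp (Or A B) (Or A C))"
    using B cl(1) by (rule Or_mono)
  also have "provable (Imp (Or A C) (Or C A))"
    using cl by (intro Imp_Or_swap)
  also have "provable (Imp (Or C A) (Or C C))"
    using A cl(2) by (rule Or_mono)
  also have "provable (Imp (Or C C) C)"
    using cl(2) by (rule Or_idem)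
  finally show ?thesis .
qed

text \<open>
  The relations implied by a fixed relation \<open>H\<close> are closed under modus ponens. This is the
  substance of the deduction theorem.
\<close>

lemma Imp_modus_ponens:
  assumes A: "provable (Imp H A)" and AB: "provable (Imp H (Imp A B))"
  shows "provable (Imp H B)"
proof -
  have cl: "closed_rel 0 H" "closed_rel 0 A" "closed_rel 0 B"
    using Imp_closed[OF AB] by auto
  note AB
  also have "provable (Imp (Imp A B) (Or B (Neg A)))"
    unfolding Imp_def[of A] using cl by (intro Imp_Or_swap) auto
  also have "provable (Imp (Or B (Neg A)) (Or B (Neg H)))"
    using cl A by (intro Or_mono Imp_contrapos)
  also have "provable (Imp (Or B (Neg H)) (Imp H B))"
    unfolding Imp_def[of H] using cl by (intro Imp_Or_swap) auto
  finally have "provable (Or (Neg H) (Imp H B))"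
    by (simp add: Imp_def)
  moreover have "provable (Imp (Or (Neg H) (Imp H B)) (Imp H B))"
    using cl by (intro Or_elim Imp_refl Neg_Imp) auto
  ultimately show ?thesis
    by (rule modus_ponens)
qed

lemma Imp_And:
  assumes A: "provable (Imp H A)" and B: "provable (Imp H B)"
  shows "provable (Imp H (And A B))"
proof -
  have "provable (Imp H (Neg (Neg H)))"
    using Imp_closed(1)[OF A] by (rule Imp_Neg_Neg)
  also have "provable (Imp (Neg (Neg H)) (And A B))"
    unfolding And_def using A B by (intro Imp_contrapos Or_elim)
  finally show ?thesis .
qed

lemma And_left:
  assumes cl: "closed_rel 0 A" "closed_rel 0 B"
  shows "provable (Imp (And A B) A)"
proof -
  have "provable (Imp (And A B) (Neg (Neg A)))"
    unfolding And_def using cl by (intro Imp_contrapos Imp_Or_left) auto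
  also have "provable (Imp (Neg (Neg A)) A)"
    using cl(1) by (rule Neg_Neg_Imp)
  finally show ?thesis .
qed

lemma Iff_refl:
  assumes "closed_rel 0 A"
  shows "provable (Iff A A)"
proof -
  have "provable (Imp (Imp A A) (Iff A A))"
    unfolding Iff_def using assms by (intro Imp_And Imp_refl) auto
  then show ?thesis
    using assms Imp_refl modus_ponens by blast
qed

section \<open>Quantifiers and equality\<close>

lemma Exists_intro:
  "closed_rel 0 R \<Longrightarrow> closed_trm 0 T \<Longrightarrow> provable (Imp (subst_rel T x R) (Exists x R))"
  by (intro provable.axiom S5) auto

lemma Forall_instance:
  assumes "closed_rel 0 R" "closed_trm 0 T"
  shows "provable (Imp (Forall x R) (subst_rel T x R))"
proof -
  have "provable (Imp (Forall x R) (Neg (subst_rel T x (Neg R))))"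
    unfolding Forall_def using assms by (intro Imp_contrapos Exists_intro) auto
  also have "provable (Imp (Neg (subst_rel T x (Neg R))) (subst_rel T x R))"
    using assms by (simp add: Neg_Neg_Imp closed_subst)
  finally show ?thesis .
qed

lemma Forall_elim:
  "closed_rel 0 R \<Longrightarrow> closed_trm 0 T \<Longrightarrow> provable (Forall x R) \<Longrightarrow> provable (subst_rel T x R)"
  using Forall_instance modus_ponens by blast

text \<open>
  S7 with \<open>R\<close> for both relations gives \<open>\<tau>\<^sub>x(R) = \<tau>\<^sub>x(R)\<close>. For \<open>R\<close> chosen as \<open>x \<noteq> x\<close>, this is the one
  instance of \<open>x = x\<close> that amounts to \<open>(\<forall>x)(x = x)\<close>.
\<close>

lemma Equal_refl:
  assumes "closed_trm 0 T"
  shows "provable (Equal T T)"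
proof -
  let ?E = "Equal (Letter 0) (Letter 0)"
  let ?t = "tau 0 (Neg ?E)"
  have "provable (Forall 0 (Iff (Neg ?E) (Neg ?E)))"
    by (simp add: Forall_eq Iff_refl)
  moreover have "provable (Imp (Forall 0 (Iff (Neg ?E) (Neg ?E))) (Equal ?t ?t))"
    by (intro provable.axiom S7) auto
  ultimately have "provable (Equal ?t ?t)"
    by (rule modus_ponens)
  then have "provable (Forall 0 ?E)"
    by (simp add: Forall_eq)
  from Forall_elim[OF _ assms this] show ?thesis
    by simp
qed

lemma Equal_sym:
  assumes cl: "closed_trm 0 T" "closed_trm 0 U"
  shows "provable (Imp (Equal T U) (Equal U T))"
proof (rule Imp_modus_ponens[where A = "Equal T T"])
  obtain x where x: "x \<notin> letters_trm T"
    using ex_new_if_finite[OF infinite_UNIV_nat finite_letters(1)] by blast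
  have "provable (Imp (Equal T U)
      (Iff (subst_rel T x (Equal (Letter x) T)) (subst_rel U x (Equal (Letter x) T))))"
    using cl by (intro provable.axiom S6) auto
  then have "provable (Imp (Equal T U) (Iff (Equal T T) (Equal U T)))"
    using x by simp
  also have "provable (Imp (Iff (Equal T T) (Equal U T)) (Imp (Equal T T) (Equal U T)))"
    unfolding Iff_def using cl by (intro And_left) auto
  finally show "provable (Imp (Equal T U) (Imp (Equal T T) (Equal U T)))" .
  show "provable (Imp (Equal T U) (Equal T T))"
    using cl by (intro Imp_weaken Equal_refl) auto
qed

section \<open>Infinitely many witnesses\<close>

lemma closed_Neg_pow [simp]: "closed_rel k ((Neg ^^ n) R) \<longleftrightarrow> closed_rel k R"
  by (induction n) auto

lemma subst_Neg_pow: "subst_rel T x ((Neg ^^ n) R) = (Neg ^^ n) (subst_rel T x R)"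
  by (induction n) auto

lemma provable_Neg_pow_even:
  "provable ((Neg ^^ (2 * n)) R) \<longleftrightarrow> provable R"
  by (induction n) auto

lemma inj_tau_Neg_pow: "inj (\<lambda>n. tau x ((Neg ^^ (2 * n)) R))"
proof -
  have "link_rel x 0 ((Neg ^^ n) R) = (Neg ^^ n) (link_rel x 0 R)" for n
    by (induction n) auto
  moreover have "size ((Neg ^^ n) S) = n + size S" for n S
    by (induction n) auto
  ultimately show ?thesis
    by (auto simp: inj_on_def tau_def dest: arg_cong[where f = size])
qed

text \<open>
  The even number of negations leaves the property unchanged up to equivalence, but enters the
  expression of the witness chosen by \<open>\<tau>\<close>.
\<close>

lemma infinitely_many_witnesses:
  assumes cl: "closed_rel 0 R" "closed_trm 0 T" and R: "provable (subst_rel T x R)"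
  obtains Y :: "nat \<Rightarrow> trm"
  where "inj Y" "\<And>i. is_term (Y i)" "\<And>i. provable (subst_rel (Y i) x R)"
proof
  define Y where "Y i = tau x ((Neg ^^ (2 * i)) R)" for i
  show "inj Y"
    unfolding Y_def by (rule inj_tau_Neg_pow)
  show "is_term (Y i)" for i
    using cl by (simp add: Y_def)
  show "provable (subst_rel (Y i) x R)" for i
  proof -
    have "provable (subst_rel T x ((Neg ^^ (2 * i)) R))"
      using R by (simp only: subst_Neg_pow provable_Neg_pow_even)
    moreover have "provable (Imp (subst_rel T x ((Neg ^^ (2 * i)) R)) (Exists x ((Neg ^^ (2 * i)) R)))"
      using cl by (intro Exists_intro) auto
    ultimately have "provable (Exists x ((Neg ^^ (2 * i)) R))"
      by (rule modus_ponens)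
    then have "provable ((Neg ^^ (2 * i)) (subst_rel (Y i) x R))"
      by (simp only: Exists_def Y_def subst_Neg_pow)
    then show ?thesis
      by (simp only: provable_Neg_pow_even)
  qed
qed

section \<open>A nonempty set has an element\<close>

lemma Empty_closed [simp]:
  "letters_trm Empty = {}" "closed_trm 0 Empty"
  by (simp_all add: Empty_def Forall_eq tau_def)

text \<open>
  The two inclusions \<open>(\<forall>z)(z \<in> \<emptyset> \<Rightarrow> z \<in> X)\<close> and \<open>(\<forall>z)(z \<in> X \<Rightarrow> z \<in> \<emptyset>)\<close> are kept in the form that
  substitution into the axiom produces: each is the doubly negated instance for one term, \<open>v\<close> or
  \<open>w\<close>. In this form it does not matter whether \<open>X\<close> contains the letter that the axiom binds.
  The closed term \<open>\<emptyset>\<close> is substituted first, as it can be moved past the second quantifier.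
\<close>

lemma extensionality_instance:
  assumes X: "closed_trm 0 X"
  obtains v w where "closed_trm 0 v" "closed_trm 0 w"
    "provable (Imp (And (Neg (Neg (Imp (Elem v Empty) (Elem v X))))
                        (Neg (Neg (Imp (Elem w X) (Elem w Empty)))))
               (Equal Empty X))"
proof -
  define I where "I a b = Imp (Elem (Letter 2) (Letter a)) (Elem (Letter 2) (Letter b))" for a b
  define Q where "Q = Imp (And (Forall 2 (I 0 1)) (Forall 2 (I 1 0))) (Equal (Letter 0) (Letter 1))"
  define u where "u a b = subst_trm X 1 (subst_trm Empty 0 (tau 2 (Neg (I a b))))" for a b
  have I: "closed_rel 0 (I a b)" for a b
    by (simp add: I_def)
  have Q: "closed_rel 0 Q"
    using I by (simp add: Q_def)
  have u: "closed_trm 0 (u a b)" for a b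
    using I X by (simp add: u_def closed_subst)
  have "Subset (Letter 0) (Letter 1) = Forall 2 (I 0 1)" "Subset (Letter 1) (Letter 0) = Forall 2 (I 1 0)"
    by (simp_all add: Subset_def fresh_def I_def numeral_2_eq_2)
  then have "provable (Forall 0 (Forall 1 Q))"
    using extensionality provable.axiom by (simp add: Q_def)
  from Forall_elim[OF _ _ this, of Empty] Q
  have "provable (Forall 1 (subst_rel Empty 0 Q))"
    by (simp add: subst_Forall)
  from Forall_elim[OF _ X this] Q
  have "provable (subst_rel X 1 (subst_rel Empty 0 Q))"
    by (simp add: closed_subst)
  moreover have "subst_rel X 1 (subst_rel Empty 0 (Forall 2 (I 0 1))) =
      Neg (Neg (Imp (Elem (u 0 1) Empty) (Elem (u 0 1) X)))"
    unfolding Forall_eq u_def by (simp add: I_def)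
  moreover have "subst_rel X 1 (subst_rel Empty 0 (Forall 2 (I 1 0))) =
      Neg (Neg (Imp (Elem (u 1 0) X) (Elem (u 1 0) Empty)))"
    unfolding Forall_eq u_def by (simp add: I_def)
  ultimately show thesis
    using that[of "u 0 1" "u 1 0"] u by (simp add: Q_def)
qed

text \<open>
  If \<open>X\<close> has no element, it is itself a witness for the existence of an empty set, and \<open>\<emptyset>\<close> is
  \<open>\<tau>\<close> of that very property.
\<close>

lemma Empty_has_no_element:
  assumes X: "closed_trm 0 X" "x \<notin> letters_trm X" and T: "closed_trm 0 T"
  shows "provable (Imp (Neg (Exists x (Elem (Letter x) X))) (Neg (Elem T Empty)))"
proof -
  let ?H = "Neg (Exists x (Elem (Letter x) X))"
  let ?F = "Forall 0 (Neg (Elem (Letter 0) (Letter 1)))"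
  let ?v = "subst_trm X 1 (tau 0 (Neg (Neg (Elem (Letter 0) (Letter 1)))))"
  have v: "closed_trm 0 ?v"
    using X by (intro closed_subst) auto
  have "provable (Imp ?H (Neg (subst_rel ?v x (Elem (Letter x) X))))"
    using X v by (intro Imp_contrapos Exists_intro) auto
  also have "Neg (subst_rel ?v x (Elem (Letter x) X)) = Neg (Elem ?v X)"
    using X by simp
  also have "provable (Imp (Neg (Elem ?v X)) (Neg (Neg (Neg (Elem ?v X)))))"
    using X v by (intro Imp_Neg_Neg) auto
  also have "Neg (Neg (Neg (Elem ?v X))) = subst_rel X 1 ?F"
    unfolding Forall_eq by simp
  also have "provable (Imp (subst_rel X 1 ?F) (Exists 1 ?F))"
    using X by (intro Exists_intro) auto
  also have "Exists 1 ?F = Forall 0 (Neg (Elem (Letter 0) Empty))"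
    unfolding Exists_def Empty_def[symmetric] by (simp add: subst_Forall)
  also have "provable (Imp (Forall 0 (Neg (Elem (Letter 0) Empty)))
      (subst_rel T 0 (Neg (Elem (Letter 0) Empty))))"
    using T by (intro Forall_instance) auto
  finally show ?thesis
    by simp
qed

lemma nonempty_has_element:
  assumes X: "closed_trm 0 X" "x \<notin> letters_trm X" and ne: "provable (Neg (Equal X Empty))"
  shows "provable (Exists x (Elem (Letter x) X))"
proof -
  define H where "H = Neg (Exists x (Elem (Letter x) X))"
  obtain v w where vw: "closed_trm 0 v" "closed_trm 0 w"
    and ext: "provable (Imp (And (Neg (Neg (Imp (Elem v Empty) (Elem v X))))
                        (Neg (Neg (Imp (Elem w X) (Elem w Empty)))))
               (Equal Empty X))"
    using extensionality_instance X(1) by blast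
  \<comment> \<open>both inclusions between \<open>\<emptyset>\<close> and \<open>X\<close> hold under \<open>H\<close> because their premises are refutable\<close>
  have vacuous: "provable (Imp H (Neg (Neg (Imp A B))))"
    if A: "provable (Imp H (Neg A))" and B: "closed_rel 0 B" for A B
  proof -
    note A
    also have "provable (Imp (Neg A) (Imp A B))"
      using Imp_closed[OF A] B by (intro Neg_Imp) auto
    also have "provable (Imp (Imp A B) (Neg (Neg (Imp A B))))"
      using Imp_closed[OF A] B by (intro Imp_Neg_Neg) auto
    finally show ?thesis .
  qed
  have "provable (Imp H (Neg (subst_rel w x (Elem (Letter x) X))))"
    unfolding H_def using X vw by (intro Imp_contrapos Exists_intro) auto
  then have "provable (Imp H (Neg (Elem w X)))"
    using X by simp
  moreover have "provable (Imp H (Neg (Elem v Empty)))"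
    unfolding H_def using X vw by (intro Empty_has_no_element)
  ultimately have "provable (Imp H (And (Neg (Neg (Imp (Elem v Empty) (Elem v X))))
                        (Neg (Neg (Imp (Elem w X) (Elem w Empty))))))"
    using X vw by (intro Imp_And vacuous) auto
  also note ext
  also have "provable (Imp (Equal Empty X) (Equal X Empty))"
    using X by (intro Equal_sym) auto
  finally have "provable (Neg H)"
    using ne Imp_contrapos modus_ponens by blast
  then show ?thesis
    by (simp add: H_def)
qed

section \<open>Countability and multiplicity of sets\<close>

instance trm :: countable
  by countable_datatype

theorem mainTheorem1:
  "countable {X. is_term X}
   \<and> (\<forall>X. is_term X \<longrightarrow>
        (\<exists>Xs :: nat \<Rightarrow> trm. inj_on Xs {1..} \<and>
           (\<forall>i\<ge>1. is_term (Xs i) \<and> provable (Equal (Xs i) X))))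
   \<and> (\<forall>X. is_term X \<and> provable (Neg (Equal X Empty)) \<longrightarrow>
        infinite {Y. is_term Y \<and> provable (Elem Y X)})"
proof (intro conjI allI impI)
  show "countable {X. is_term X}"
    by simp
next
  fix X
  assume X: "is_term X"
  obtain x where x: "x \<notin> letters_trm X"
    using ex_new_if_finite[OF infinite_UNIV_nat finite_letters(1)] by blast
  have "provable (subst_rel X x (Equal (Letter x) X))"
    using X x by (simp add: Equal_refl)
  then obtain Xs :: "nat \<Rightarrow> trm" where "inj Xs" "\<And>i. is_term (Xs i)"
    "\<And>i. provable (subst_rel (Xs i) x (Equal (Letter x) X))"
    using infinitely_many_witnesses[of "Equal (Letter x) X" X x] X by auto
  then show "\<exists>Xs :: nat \<Rightarrow> trm. inj_on Xs {1..} \<and>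
      (\<forall>i\<ge>1. is_term (Xs i) \<and> provable (Equal (Xs i) X))"
    using x by (intro exI[of _ Xs]) (auto intro: inj_on_subset)
next
  fix X
  assume "is_term X \<and> provable (Neg (Equal X Empty))"
  then have X: "closed_trm 0 X" and ne: "provable (Neg (Equal X Empty))"
    by auto
  obtain x where x: "x \<notin> letters_trm X"
    using ex_new_if_finite[OF infinite_UNIV_nat finite_letters(1)] by blast
  have "provable (subst_rel (tau x (Elem (Letter x) X)) x (Elem (Letter x) X))"
    using nonempty_has_element[OF X x ne] by (simp add: Exists_def)
  then obtain Y :: "nat \<Rightarrow> trm" where Y: "inj Y" "\<And>i. is_term (Y i)"
    "\<And>i. provable (subst_rel (Y i) x (Elem (Letter x) X))"
    using infinitely_many_witnesses[of "Elem (Letter x) X" "tau x (Elem (Letter x) X)" x] X by auto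
  then have "range Y \<subseteq> {Y. is_term Y \<and> provable (Elem Y X)}"
    using x by auto
  then show "infinite {Y. is_term Y \<and> provable (Elem Y X)}"
    using Y(1) by (meson finite_subset range_inj_infinite)
qed

end
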